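(* Let $v,w\in S_n$. The Kazhdan-Lusztig ideal $I_{v,w}$ is the whole ring $\mathbb{C}[\mathbf{z}^{(v)}]$ if and only if $\tilde R_v\nleq\tilde R_w$.
   Context: For $w\in S_n$, let $\tilde R_w=[\tilde r_{s,t}^{(w)}]_{s,t=1}^n$ with $\tilde r_{s,t}^{(w)}=\#\{k\mid k\le t,\ w(k)\ge s\}$. For matrices $A=[a_{ij}]$, $B=[b_{ij}]$ of the same size, $A\le B$ means $a_{ij}\le b_{ij}$ for all $i,j$; otherwise $A\nleq B$. Number the rows of $n\times n$ matrices from bottom to top for indexing the variables $z_{ij}$. For $v\in S_n$, $Z^{(v)}$ is the $n\times n$ matrix whose entry in row $i$ from the bottom and column $j$ from the left is: $1$ if $i=n-v(j)+1$; $0$ if $i>n-v(j)+1$; $0$ if $i=n-v(j')+1$ for some $j'<j$; and an indeterminate $z_{ij}$ otherwise. Let $\mathbf{z}^{(v)}$ be the set of indeterminates appearing in $Z^{(v)}$. For $1\le s,t\le n$ let $Z_{st}^{(v)}$ be the southwest (bottom-left) $(n-s+1)\times t$ submatrix of $Z^{(v)}$. The Kazhdan-Lusztig ideal $I_{v,w}\subset\mathbb{C}[\mathbf{z}^{(v)}]$ is the ideal generated by all minors (determinants of square submatrices) of size $\tilde r_{s,t}^{(w)}+1$ of $Z_{st}^{(v)}$, for all $1\le s,t\le n$ (no minors are contributed by $(s,t)$ if $\tilde r_{s,t}^{(w)}+1>\min\{n-s+1,t\}$). *)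

theory Defs
  imports
    "HOL-Library.Poly_Mapping"
    "HOL-Algebra.Ideal"
    "Jordan_Normal_Form.Determinant"
    "Jordan_Normal_Form.DL_Submatrix"
begin

(* A monomial maps a variable (i, j) to its exponent; a polynomial maps a monomial to its
   coefficient. *)
type_synonym cpoly = "((nat \<times> nat) \<Rightarrow>\<^sub>0 nat) \<Rightarrow>\<^sub>0 complex"

definition zvar :: "nat \<Rightarrow> nat \<Rightarrow> cpoly" where
  "zvar i j = Poly_Mapping.single (Poly_Mapping.single (i, j) 1) 1"

definition vars :: "cpoly \<Rightarrow> (nat \<times> nat) set" where
  "vars p = (\<Union>m \<in> Poly_Mapping.keys p. Poly_Mapping.keys m)"

definition poly_ring_on :: "(nat \<times> nat) set \<Rightarrow> cpoly ring" where
  "poly_ring_on X =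
     \<lparr>carrier = {p. vars p \<subseteq> X}, monoid.mult = (*), one = 1, zero = 0, add = (+)\<rparr>"

(* An element w of S_n is a function with w permutes {1..n}. *)
definition rtilde :: "nat \<Rightarrow> (nat \<Rightarrow> nat) \<Rightarrow> nat \<Rightarrow> nat \<Rightarrow> nat" where
  "rtilde n w s t = card {k \<in> {1..n}. k \<le> t \<and> w k \<ge> s}"

(* Library matrices are indexed from 0, with row 0 on top.  The order on them is entrywise
   (less_eq_mat_def). *)
definition Rtilde :: "nat \<Rightarrow> (nat \<Rightarrow> nat) \<Rightarrow> nat mat" where
  "Rtilde n w = mat n n (\<lambda>(a, b). rtilde n w (a + 1) (b + 1))"

(* i is the row number counted from the bottom, j the column number counted from the left,
   both starting at 1. *)
definition Z_entry :: "nat \<Rightarrow> (nat \<Rightarrow> nat) \<Rightarrow> nat \<Rightarrow> nat \<Rightarrow> cpoly" where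
  "Z_entry n v i j =
     (if i = n - v j + 1 then 1
      else if i > n - v j + 1 then 0
      else if \<exists>j'. 1 \<le> j' \<and> j' < j \<and> i = n - v j' + 1 then 0
      else zvar i j)"

(* Row a of the library matrix is row n - a from the bottom. *)
definition Z_mat :: "nat \<Rightarrow> (nat \<Rightarrow> nat) \<Rightarrow> cpoly mat" where
  "Z_mat n v = mat n n (\<lambda>(a, b). Z_entry n v (n - a) (b + 1))"

definition Z_vars :: "nat \<Rightarrow> (nat \<Rightarrow> nat) \<Rightarrow> (nat \<times> nat) set" where
  "Z_vars n v = (\<Union>p \<in> elements_mat (Z_mat n v). vars p)"

definition Z_southwest :: "nat \<Rightarrow> (nat \<Rightarrow> nat) \<Rightarrow> nat \<Rightarrow> nat \<Rightarrow> cpoly mat" where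
  "Z_southwest n v s t = submatrix (Z_mat n v) {s - 1..<n} {0..<t}"

definition minors :: "nat \<Rightarrow> 'a :: comm_ring_1 mat \<Rightarrow> 'a set" where
  "minors k A = {det (submatrix A I J) | I J.
     I \<subseteq> {0..<dim_row A} \<and> J \<subseteq> {0..<dim_col A} \<and> card I = k \<and> card J = k}"

definition KL_generators :: "nat \<Rightarrow> (nat \<Rightarrow> nat) \<Rightarrow> (nat \<Rightarrow> nat) \<Rightarrow> cpoly set" where
  "KL_generators n v w =
     (\<Union>s \<in> {1..n}. \<Union>t \<in> {1..n}. minors (rtilde n w s t + 1) (Z_southwest n v s t))"

definition KL_ring :: "nat \<Rightarrow> (nat \<Rightarrow> nat) \<Rightarrow> cpoly ring" where
  "KL_ring n v = poly_ring_on (Z_vars n v)"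

definition KL_ideal :: "nat \<Rightarrow> (nat \<Rightarrow> nat) \<Rightarrow> (nat \<Rightarrow> nat) \<Rightarrow> cpoly set" where
  "KL_ideal n v w = genideal (KL_ring n v) (KL_generators n v w)"


lemma vars_simps [simp]: "vars 0 = {}" "vars 1 = {}" "vars (- p) = vars p" "vars (zvar i j) = {(i, j)}"
  by (auto simp: vars_def zvar_def)

lemma vars_add: "vars (p + q) \<subseteq> vars p \<union> vars q"
  using Poly_Mapping.keys_add[of p q] by (auto simp: vars_def)

lemma vars_mult: "vars (p * q) \<subseteq> vars p \<union> vars q"
proof
  fix x assume "x \<in> vars (p * q)"
  then obtain m where m: "m \<in> Poly_Mapping.keys (p * q)" "x \<in> Poly_Mapping.keys m"
    by (auto simp: vars_def)
  from m(1) obtain a b where "m = a + b" "a \<in> Poly_Mapping.keys p" "b \<in> Poly_Mapping.keys q"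
    using keys_mult[of p q] by blast
  with m(2) show "x \<in> vars p \<union> vars q"
    using Poly_Mapping.keys_add[of a b] by (auto simp: vars_def)
qed

lemma poly_ring_on_simps [simp]:
  "carrier (poly_ring_on X) = {p. vars p \<subseteq> X}"
  "p \<otimes>\<^bsub>poly_ring_on X\<^esub> q = p * q" "\<one>\<^bsub>poly_ring_on X\<^esub> = 1"
  "p \<oplus>\<^bsub>poly_ring_on X\<^esub> q = p + q" "\<zero>\<^bsub>poly_ring_on X\<^esub> = 0"
  by (simp_all add: poly_ring_on_def)

lemma cring_poly_ring_on: "cring (poly_ring_on X)"
proof (rule cringI)
  show "abelian_group (poly_ring_on X)"
  proof (rule abelian_groupI)
    fix p q assume "p \<in> carrier (poly_ring_on X)" "q \<in> carrier (poly_ring_on X)"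
    then show "p \<oplus>\<^bsub>poly_ring_on X\<^esub> q \<in> carrier (poly_ring_on X)"
      using vars_add[of p q] by auto
  next
    fix p assume "p \<in> carrier (poly_ring_on X)"
    then show "\<exists>q \<in> carrier (poly_ring_on X). q \<oplus>\<^bsub>poly_ring_on X\<^esub> p = \<zero>\<^bsub>poly_ring_on X\<^esub>"
      by (intro bexI[of _ "- p"]) simp_all
  qed (simp_all add: ac_simps)
  show "Group.comm_monoid (poly_ring_on X)"
  proof (rule comm_monoidI)
    fix p q assume "p \<in> carrier (poly_ring_on X)" "q \<in> carrier (poly_ring_on X)"
    then show "p \<otimes>\<^bsub>poly_ring_on X\<^esub> q \<in> carrier (poly_ring_on X)"
      using vars_mult[of p q] by auto
  qed (simp_all add: ac_simps)
qed (simp add: distrib_right)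

lemma Z_vars_eq:
  "Z_vars n v = {(i, j). i \<in> {1..n} \<and> j \<in> {1..n} \<and> i < n - v j + 1 \<and>
     (\<forall>j'. 1 \<le> j' \<and> j' < j \<longrightarrow> i \<noteq> n - v j' + 1)}" (is "?L = ?R")
proof
  show "?L \<subseteq> ?R"
    by (auto simp: Z_vars_def elements_mat_def Z_mat_def Z_entry_def split: if_splits)
  show "?R \<subseteq> ?L"
  proof clarify
    fix i j assume *: "i \<in> {1..n}" "j \<in> {1..n}" "i < n - v j + 1"
      "\<forall>j'. 1 \<le> j' \<and> j' < j \<longrightarrow> i \<noteq> n - v j' + 1"
    then have "Z_mat n v $$ (n - i, j - 1) = zvar i j"
      by (auto simp: Z_mat_def Z_entry_def)
    moreover have "Z_mat n v $$ (n - i, j - 1) \<in> elements_mat (Z_mat n v)"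
      using * by (intro elements_matI[of _ n n "n - i" "j - 1"]) (auto simp: Z_mat_def)
    ultimately show "(i, j) \<in> ?L"
      by (auto simp: Z_vars_def intro!: bexI[of _ "zvar i j"])
  qed
qed

lemma vars_det:
  assumes "\<And>i j. i < dim_row A \<Longrightarrow> j < dim_col A \<Longrightarrow> vars (A $$ (i, j)) \<subseteq> X"
  shows "vars (det A) \<subseteq> X"
proof (cases "dim_row A = dim_col A")
  case True
  have sum: "vars (sum f S) \<subseteq> X" if "\<And>x. x \<in> S \<Longrightarrow> vars (f x) \<subseteq> X" for f and S :: "(nat \<Rightarrow> nat) set"
    using that
  proof (induction S rule: infinite_finite_induct)
    case (insert x S)
    then show ?case using vars_add[of "f x" "sum f S"] by auto
  qed auto
  have prod: "vars (prod f S) \<subseteq> X" if "\<And>x. x \<in> S \<Longrightarrow> vars (f x) \<subseteq> X" for f and S :: "nat set"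
    using that
  proof (induction S rule: infinite_finite_induct)
    case (insert x S)
    then show ?case using vars_mult[of "f x" "prod f S"] by auto
  qed auto
  have "vars (signof p * (\<Prod>i = 0..<dim_row A. A $$ (i, p i))) \<subseteq> X"
    if "p permutes {0..<dim_row A}" for p
  proof -
    have "vars (\<Prod>i = 0..<dim_row A. A $$ (i, p i)) \<subseteq> X"
      using that True permutes_in_image[OF that] by (intro prod assms) auto
    then show ?thesis by (auto simp: sign_def)
  qed
  then show ?thesis using True unfolding det_def by (auto intro!: sum)
qed (auto simp: det_def)

lemma vars_submatrix:
  assumes "\<And>i j. i < dim_row A \<Longrightarrow> j < dim_col A \<Longrightarrow> vars (A $$ (i, j)) \<subseteq> X"
    and "i < dim_row (submatrix A I J)" "j < dim_col (submatrix A I J)"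
  shows "vars (submatrix A I J $$ (i, j)) \<subseteq> X"
proof -
  have i: "i < card {i. i < dim_row A \<and> i \<in> I}" and j: "j < card {j. j < dim_col A \<and> j \<in> J}"
    using assms(2,3) by (auto simp: dim_submatrix)
  show ?thesis
    unfolding submatrix_index[OF i j] using pick_le[OF i] pick_le[OF j] by (rule assms(1))
qed

lemma KL_generators_subset: "KL_generators n v w \<subseteq> carrier (KL_ring n v)"
proof -
  have Z: "vars (Z_mat n v $$ (i, j)) \<subseteq> Z_vars n v"
    if "i < dim_row (Z_mat n v)" "j < dim_col (Z_mat n v)" for i j
    using that unfolding Z_vars_def by (intro UN_upper elements_matI[of _ _ _ i j]) auto
  have "vars (det (submatrix (Z_southwest n v s t) I J)) \<subseteq> Z_vars n v" for s t I J
    unfolding Z_southwest_def by (intro vars_det vars_submatrix Z)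
  then show ?thesis
    by (simp add: KL_generators_def minors_def KL_ring_def poly_ring_on_def) blast
qed

lemma Z_southwest_carrier:
  assumes "s \<in> {1..n}" "t \<in> {1..n}"
  shows "Z_southwest n v s t \<in> carrier_mat (n - s + 1) t"
proof (rule carrier_matI)
  have "{i. i < n \<and> i \<in> {s - 1..<n}} = {s - 1..<n}" "{j. j < n \<and> j \<in> {0..<t}} = {0..<t}"
    using assms by auto
  moreover have "n - (s - 1) = n - s + 1"
    using assms by auto
  ultimately show "dim_row (Z_southwest n v s t) = n - s + 1" "dim_col (Z_southwest n v s t) = t"
    unfolding Z_southwest_def dim_submatrix Z_mat_def dim_row_mat dim_col_mat
    by (simp_all only: card_atLeastLessThan diff_zero)
qed

end

theory Submission
  imports Defs
begin

text \<open>
  Up to the order of the rows, \<open>Z_mat n v\<close> is unitriangular: each row and each column has one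
  distinguished 1, with zeros above it in its column and to its right in its row.  Setting all
  indeterminates to 0 leaves the permutation matrix of \<open>v\<close>, and the number of its ones in the
  \<open>(s, t)\<close> southwest block is \<open>rtilde n v s t\<close>.

  If the block \<open>(s, t)\<close> holds more than \<open>rtilde n w s t\<close> ones, choose \<open>rtilde n w s t + 1\<close> of them.
  The minor on their rows and columns is again unitriangular up to the order of the rows, so it
  is \<open>1\<close> or \<open>-1\<close> (\<open>unit_minor_Z_southwest\<close>), and the ideal contains a unit.  If no block \<open>(s, t)\<close>
  holds that many ones, then every term of a minor of size \<open>rtilde n w s t + 1\<close> vanishes once the
  indeterminates are set to 0, because a nonzero term needs a 1 in each of the columns of the minor
  (\<open>lookup_minor_Z_southwest_zero_eq_0\<close>).  Hence all generators lie in the proper ideal of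
  polynomials with constant coefficient 0.
\<close>

section \<open>Minors that are unitriangular up to the order of the rows\<close>

text \<open>
  The chosen row \<open>f b\<close> carries the 1 of column \<open>b\<close>.  Listing the chosen rows in the order of
  their columns gives a lower unitriangular matrix; this reordering costs at most a sign.
\<close>
lemma det_submatrix_unitriangular_up_to_row_order:
  fixes A :: "'a :: comm_ring_1 mat"
  assumes J: "J \<subseteq> {0..<dim_col A}" and f: "inj_on f J" "f ` J \<subseteq> {0..<dim_row A}"
    and one: "\<And>b. b \<in> J \<Longrightarrow> A $$ (f b, b) = 1"
    and zero: "\<And>b b'. b \<in> J \<Longrightarrow> b' \<in> J \<Longrightarrow> b < b' \<Longrightarrow> A $$ (f b, b') = 0"
  shows "det (submatrix A (f ` J) J) \<in> {1, - 1}"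
proof -
  let ?I = "f ` J" and ?S = "submatrix A (f ` J) J"
  define m where "m = card J"
  have fin: "finite J" "finite ?I"
    using J finite_subset by auto
  have cI: "card ?I = m" using f(1) by (simp add: card_image m_def)
  have sets: "{i. i < dim_row A \<and> i \<in> ?I} = ?I" "{j. j < dim_col A \<and> j \<in> J} = J"
    using J f(2) by auto
  have S: "?S \<in> carrier_mat m m"
    by (rule carrier_matI) (simp_all add: dim_submatrix sets cI m_def)
  have S_idx: "?S $$ (i, j) = A $$ (pick ?I i, pick J j)" if "i < m" "j < m" for i j
    using that by (intro submatrix_index) (simp_all add: sets cI m_def)
  have pickJ: "pick J b \<in> J" if "b < m" for b
    using that by (intro pick_in_set_le) (simp add: m_def)
  have pickJ_less: "pick J b < pick J b'" if "b < b'" "b' < m" for b b'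
    using that by (intro pick_mono_le) (auto simp: m_def)
  define \<sigma> where "\<sigma> b = (if b < m then card {a \<in> ?I. a < f (pick J b)} else b)" for b
  have pick\<sigma>: "pick ?I (\<sigma> b) = f (pick J b)" if "b < m" for b
    using that pickJ[OF that] by (auto simp: \<sigma>_def intro!: pick_card_in_set)
  have \<sigma>_less: "\<sigma> b < m" if "b < m" for b
  proof -
    have "{a \<in> ?I. a < f (pick J b)} \<subset> ?I"
      using pickJ[OF that] by auto
    then show ?thesis
      using that psubset_card_mono[OF fin(2)] by (simp add: \<sigma>_def cI)
  qed
  have inj: "inj_on \<sigma> {0..<m}"
  proof (rule inj_onI)
    fix b b' assume b: "b \<in> {0..<m}" "b' \<in> {0..<m}" "\<sigma> b = \<sigma> b'"
    then have "f (pick J b) = f (pick J b')"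
      using pick\<sigma>[of b] pick\<sigma>[of b'] by simp
    then have "pick J b = pick J b'"
      using b pickJ by (auto dest: inj_onD[OF f(1)])
    then show "b = b'"
      using b pickJ_less[of b b'] pickJ_less[of b' b] by (cases b b' rule: linorder_cases) auto
  qed
  moreover have "\<sigma> ` {0..<m} = {0..<m}"
    using inj \<sigma>_less by (intro endo_inj_surj) auto
  ultimately have \<sigma>: "\<sigma> permutes {0..<m}"
    by (intro bij_imp_permutes) (auto simp: bij_betw_def \<sigma>_def)
  let ?U = "mat m m (\<lambda>(i, j). ?S $$ (\<sigma> i, j))"
  have U: "?U $$ (i, j) = A $$ (f (pick J i), pick J j)" if "i < m" "j < m" for i j
    using that \<sigma>_less by (simp add: S_idx pick\<sigma>)
  have "det ?U = prod_list (diag_mat ?U)"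
  proof (rule det_lower_triangular)
    fix i j assume "i < j" "j < m"
    then show "?U $$ (i, j) = 0"
      using U[of i j] pickJ pickJ_less zero by simp
  qed simp
  also have "diag_mat ?U = map (\<lambda>i. 1) [0..<m]"
    using U pickJ one by (auto simp: diag_mat_def)
  finally have "det ?U = 1"
    by (simp add: map_replicate_const)
  then have "signof \<sigma> * det ?S = 1"
    using det_permute_rows[OF S \<sigma>] by simp
  then show ?thesis
    by (cases \<sigma> rule: sign_cases) (auto simp: minus_equation_iff)
qed

section \<open>The entries of the southwest blocks\<close>

lemma pick_atLeastLessThan:
  assumes "a < n - m"
  shows "pick {m..<n} a = m + a"
proof -
  have "{x \<in> {m..<n}. x < m + a} = {m..<m + a}"
    using assms by auto
  then show ?thesis
    using pick_card_in_set[of "m + a" "{m..<n}"] assms by simp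
qed

text \<open>
  Counted from the top, the 1 of column \<open>b + 1\<close> is in row \<open>v (b + 1)\<close>, so the shift to the top
  row \<open>s\<close> of the block replaces all truncated subtractions by comparisons with \<open>s + a\<close>.
\<close>
lemma Z_southwest_index:
  assumes v: "v permutes {1..n}" and s: "s \<in> {1..n}" and t: "t \<in> {1..n}"
    and a: "a < n - s + 1" and b: "b < t"
  shows "Z_southwest n v s t $$ (a, b) =
    (if v (b + 1) = s + a then 1 else if s + a < v (b + 1) then 0
     else if \<exists>b'<b. v (b' + 1) = s + a then 0 else zvar (n - (s + a) + 1) (b + 1))"
proof -
  have sets: "{i. i < n \<and> i \<in> {s - 1..<n}} = {s - 1..<n}" "{j. j < n \<and> j \<in> {0..<t}} = {0..<t}"
    using t by auto
  have less: "a < card {s - 1..<n}" "b < card {0..<t}"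
    using s a b by auto
  have "Z_southwest n v s t $$ (a, b) = Z_mat n v $$ (pick {s - 1..<n} a, pick {0..<t} b)"
    unfolding Z_southwest_def
    by (rule submatrix_index) (simp_all only: Z_mat_def dim_row_mat dim_col_mat sets less)
  also have "\<dots> = Z_mat n v $$ (s - 1 + a, b)"
    using less b by (simp only: pick_atLeastLessThan card_atLeastLessThan) simp
  also have "\<dots> = Z_entry n v (n - (s + a) + 1) (b + 1)"
  proof -
    have "n - (s - 1 + a) = n - (s + a) + 1" using s a by auto
    then show ?thesis using s t a b by (auto simp: Z_mat_def simp del: add_Suc_right)
  qed
  finally have Z: "Z_southwest n v s t $$ (a, b) = Z_entry n v (n - (s + a) + 1) (b + 1)" .
  have v_range: "v (c + 1) \<in> {1..n}" if "c \<le> b" for c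
    using permutes_in_image[OF v, of "c + 1"] that b t by simp
  have sa: "s + a \<le> n" using s a by auto
  have row_eq: "n - (s + a) + 1 = n - v (c + 1) + 1 \<longleftrightarrow> v (c + 1) = s + a" if "c \<le> b" for c
    using v_range[OF that] sa by auto
  have row_gt: "n - (s + a) + 1 > n - v (b + 1) + 1 \<longleftrightarrow> s + a < v (b + 1)"
    using v_range[of b] sa by auto
  have "(\<exists>j'. 1 \<le> j' \<and> j' < b + 1 \<and> n - (s + a) + 1 = n - v j' + 1) \<longleftrightarrow>
        (\<exists>b'<b. v (b' + 1) = s + a)" (is "?L \<longleftrightarrow> ?R")
  proof
    assume ?L
    then obtain j' where j': "1 \<le> j'" "j' < b + 1" "n - (s + a) + 1 = n - v j' + 1" by blast
    then show ?R using row_eq[of "j' - 1"] by (intro exI[of _ "j' - 1"]) auto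
  next
    assume ?R
    then obtain b' where "b' < b" "v (b' + 1) = s + a" by blast
    then show ?L by (intro exI[of _ "b' + 1"]) auto
  qed
  then show ?thesis
    unfolding Z Z_entry_def row_gt row_eq[OF order.refl] by simp
qed

lemma rtilde_eq_card_columns:
  assumes "t \<le> n"
  shows "rtilde n v s t = card {b. b < t \<and> s \<le> v (b + 1)}"
proof -
  have "{k \<in> {1..n}. k \<le> t \<and> s \<le> v k} = Suc ` {b. b < t \<and> s \<le> v (b + 1)}" (is "?L = ?R")
  proof
    show "?L \<subseteq> ?R"
    proof
      fix k assume "k \<in> ?L"
      then show "k \<in> ?R" by (intro image_eqI[of _ _ "k - 1"]) auto
    qed
  qed (use assms in auto)
  then show ?thesis
    unfolding rtilde_def by (simp add: card_image)
qed

section \<open>A unit among the minors\<close>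

lemma unit_minor_Z_southwest:
  assumes v: "v permutes {1..n}" and s: "s \<in> {1..n}" and t: "t \<in> {1..n}"
    and m: "m \<le> rtilde n v s t"
  shows "\<exists>d \<in> minors m (Z_southwest n v s t). d \<in> {1, - 1}"
proof -
  let ?A = "Z_southwest n v s t"
  have A: "dim_row ?A = n - s + 1" "dim_col ?A = t"
    using Z_southwest_carrier[OF s t, of v] by auto
  obtain J where J: "J \<subseteq> {b. b < t \<and> s \<le> v (b + 1)}" "card J = m"
    using m t by (auto simp: rtilde_eq_card_columns elim: obtain_subset_with_card_n)
  \<comment> \<open>Row \<open>a\<close> of the block is row \<open>s + a\<close> from the top of the whole matrix, counted from 1.\<close>
  define f where "f b = v (b + 1) - s" for b
  have v_range: "v (b + 1) \<in> {s..n}" if "b \<in> J" for b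
    using permutes_in_image[OF v, of "b + 1"] that J(1) t by auto
  have sf: "s + f b = v (b + 1)" if "b \<in> J" for b
    using v_range[OF that] by (simp add: f_def)
  have f_less: "f b < n - s + 1" if "b \<in> J" for b
    using v_range[OF that] by (auto simp: f_def)
  have inj: "inj_on f J"
  proof (rule inj_onI)
    fix b b' assume "b \<in> J" "b' \<in> J" "f b = f b'"
    then have "v (b + 1) = v (b' + 1)" using sf[of b] sf[of b'] by simp
    then show "b = b'" using permutes_inj[OF v] by (auto dest: injD)
  qed
  have idx: "?A $$ (f b, b') =
      (if v (b' + 1) = v (b + 1) then 1 else if v (b + 1) < v (b' + 1) then 0
       else if \<exists>c<b'. v (c + 1) = v (b + 1) then 0 else zvar (n - v (b + 1) + 1) (b' + 1))"
    if "b \<in> J" "b' \<in> J" for b b'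
  proof -
    have "b' < t" using that J(1) by auto
    then show ?thesis
      by (simp only: Z_southwest_index[OF v s t f_less[OF that(1)]] sf[OF that(1)])
  qed
  have "det (submatrix ?A (f ` J) J) \<in> {1, - 1}"
  proof (rule det_submatrix_unitriangular_up_to_row_order)
    fix b b' assume "b \<in> J" "b' \<in> J" "b < b'"
    moreover from this have "v (b' + 1) \<noteq> v (b + 1)"
      using permutes_inj[OF v] by (auto dest: injD)
    ultimately show "?A $$ (f b, b') = 0" using idx[of b b'] by auto
  qed (use J(1) A inj f_less idx in auto)
  moreover have "det (submatrix ?A (f ` J) J) \<in> minors m ?A"
    unfolding minors_def
    by (rule CollectI, rule exI[of _ "f ` J"], rule exI[of _ J])
       (use J A f_less inj in \<open>auto simp: card_image\<close>)
  ultimately show ?thesis by blast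
qed

section \<open>Constant coefficients\<close>

text \<open>
  Exponents are natural numbers, so the monomial 1 factors only as \<open>1 * 1\<close>.
\<close>
lemma lookup_mult_zero_eq_0:
  fixes p q :: cpoly
  assumes "Poly_Mapping.lookup p 0 = 0"
  shows "Poly_Mapping.lookup (p * q) 0 = 0"
proof (rule ccontr)
  assume "Poly_Mapping.lookup (p * q) 0 \<noteq> 0"
  then have "0 \<in> Poly_Mapping.keys (p * q)" by (simp add: in_keys_iff)
  then obtain a b where ab: "0 = a + b" "a \<in> Poly_Mapping.keys p"
    using keys_mult[of p q] by blast
  have "a = 0"
  proof (rule poly_mapping_eqI)
    fix x
    have "Poly_Mapping.lookup a x + Poly_Mapping.lookup b x = 0"
      using arg_cong[OF ab(1), of "\<lambda>m. Poly_Mapping.lookup m x"] by (simp add: lookup_add)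
    then show "Poly_Mapping.lookup a x = Poly_Mapping.lookup 0 x" by simp
  qed
  with ab(2) assms show False by (simp add: in_keys_iff)
qed

lemma ideal_zero_constant_coeff:
  "ideal {p \<in> carrier (poly_ring_on X). Poly_Mapping.lookup p 0 = 0} (poly_ring_on X)" (is "ideal ?N ?R")
proof -
  interpret R: cring "poly_ring_on X" by (rule cring_poly_ring_on)
  have "subgroup ?N (add_monoid ?R)"
  proof (rule R.add.subgroupI)
    fix p assume p: "p \<in> ?N"
    then have "\<ominus>\<^bsub>?R\<^esub> p = - p"
      by (intro R.minus_equality) auto
    with p show "\<ominus>\<^bsub>?R\<^esub> p \<in> ?N"
      by simp
  next
    fix p q assume "p \<in> ?N" "q \<in> ?N"
    then show "p \<oplus>\<^bsub>?R\<^esub> q \<in> ?N"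
      using vars_add[of p q] by (auto simp: lookup_add)
  qed (auto intro: exI[of _ 0])
  then show ?thesis
  proof (rule idealI[OF R.ring_axioms])
    fix p q assume pq: "p \<in> ?N" "q \<in> carrier ?R"
    then show "q \<otimes>\<^bsub>?R\<^esub> p \<in> ?N" "p \<otimes>\<^bsub>?R\<^esub> q \<in> ?N"
      using vars_mult[of p q] lookup_mult_zero_eq_0[of p q] by (auto simp: mult.commute[of q p])
  qed
qed

lemma lookup_zvar_zero: "Poly_Mapping.lookup (zvar i j) 0 = 0"
proof -
  have "Poly_Mapping.single (i, j) (1 :: nat) \<noteq> 0"
    by (metis lookup_single_eq lookup_zero zero_neq_one)
  then show ?thesis by (simp add: zvar_def lookup_single_not_eq)
qed

lemma lookup_det_zero_eq_0:
  fixes A :: "cpoly mat"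
  assumes "A \<in> carrier_mat m m"
    and "\<And>p. p permutes {0..<m} \<Longrightarrow> \<exists>i<m. Poly_Mapping.lookup (A $$ (i, p i)) 0 = 0"
  shows "Poly_Mapping.lookup (det A) 0 = 0"
proof -
  have "Poly_Mapping.lookup (signof p * (\<Prod>i = 0..<m. A $$ (i, p i))) 0 = 0" if p: "p permutes {0..<m}" for p
  proof -
    obtain i where i: "i < m" "Poly_Mapping.lookup (A $$ (i, p i)) 0 = 0"
      using assms(2)[OF p] by blast
    have "(\<Prod>i = 0..<m. A $$ (i, p i)) = A $$ (i, p i) * (\<Prod>j \<in> {0..<m} - {i}. A $$ (j, p j))"
      using i(1) by (intro prod.remove) auto
    then show ?thesis
      using lookup_mult_zero_eq_0[OF i(2)] by (simp only: mult.left_commute[of "signof p"])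
  qed
  then show ?thesis
    using assms(1) by (auto simp: det_def lookup_sum intro!: sum.neutral)
qed

text \<open>
  A term of the minor with a nonzero constant coefficient picks, in each of its \<open>m\<close> columns,
  the 1 of this column, so these columns are among those with their 1 in the block.
\<close>
lemma lookup_minor_Z_southwest_zero_eq_0:
  assumes v: "v permutes {1..n}" and s: "s \<in> {1..n}" and t: "t \<in> {1..n}"
    and m: "rtilde n v s t < m" and d: "d \<in> minors m (Z_southwest n v s t)"
  shows "Poly_Mapping.lookup d 0 = 0"
proof -
  let ?A = "Z_southwest n v s t"
  have A: "dim_row ?A = n - s + 1" "dim_col ?A = t"
    using Z_southwest_carrier[OF s t, of v] by auto
  obtain I J where IJ: "I \<subseteq> {0..<n - s + 1}" "J \<subseteq> {0..<t}" "card I = m" "card J = m"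
    and d: "d = det (submatrix ?A I J)"
    using d A by (auto simp: minors_def)
  have sets: "{i. i < dim_row ?A \<and> i \<in> I} = I" "{j. j < dim_col ?A \<and> j \<in> J} = J"
    using IJ A by auto
  show ?thesis
    unfolding d
  proof (rule lookup_det_zero_eq_0)
    show "submatrix ?A I J \<in> carrier_mat m m"
      by (rule carrier_matI) (simp_all add: dim_submatrix sets IJ)
    fix p assume p: "p permutes {0..<m}"
    show "\<exists>i<m. Poly_Mapping.lookup (submatrix ?A I J $$ (i, p i)) 0 = 0"
    proof (rule ccontr)
      assume "\<not> ?thesis"
      then have nz: "Poly_Mapping.lookup (submatrix ?A I J $$ (i, p i)) 0 \<noteq> 0" if "i < m" for i
        using that by blast
      define c where "c i = pick J (p i)" for i
      have pm: "p i < m" if "i < m" for i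
        using permutes_in_image[OF p, of i] that by simp
      have "c i < t \<and> s \<le> v (c i + 1)" if i: "i < m" for i
      proof -
        have r: "pick I i \<in> I" and c: "c i \<in> J"
          unfolding c_def using i pm[OF i] IJ by (auto intro!: pick_in_set_le)
        have "submatrix ?A I J $$ (i, p i) = ?A $$ (pick I i, c i)"
          unfolding c_def using i pm[OF i] by (intro submatrix_index) (simp_all add: sets IJ)
        then have "Poly_Mapping.lookup (?A $$ (pick I i, c i)) 0 \<noteq> 0"
          using nz[OF i] by simp
        moreover have "pick I i < n - s + 1" "c i < t" using r c IJ by auto
        ultimately show ?thesis
          using Z_southwest_index[OF v s t, of "pick I i" "c i"]
          by (auto simp: lookup_zvar_zero split: if_splits)
      qed
      then have "c ` {0..<m} \<subseteq> {b. b < t \<and> s \<le> v (b + 1)}" by auto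
      moreover have "inj_on c {0..<m}"
      proof (rule inj_onI)
        fix i j assume ij: "i \<in> {0..<m}" "j \<in> {0..<m}" "c i = c j"
        then have "p i = p j"
          using pick_mono_le[of "p i" J "p j"] pick_mono_le[of "p j" J "p i"] pm[of i] pm[of j] IJ(4)
          by (cases "p i" "p j" rule: linorder_cases) (auto simp: c_def)
        then show "i = j" using permutes_inj[OF p] by (auto dest: injD)
      qed
      ultimately have "m \<le> card {b. b < t \<and> s \<le> v (b + 1)}"
        using card_inj_on_le[of c "{0..<m}"] by simp
      then show False using m t by (simp add: rtilde_eq_card_columns)
    qed
  qed
qed

section \<open>The Kazhdan-Lusztig ideal\<close>

lemma Rtilde_le_iff:
  "Rtilde n v \<le> Rtilde n w \<longleftrightarrow> (\<forall>s \<in> {1..n}. \<forall>t \<in> {1..n}. rtilde n v s t \<le> rtilde n w s t)"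
proof
  assume le: "Rtilde n v \<le> Rtilde n w"
  show "\<forall>s \<in> {1..n}. \<forall>t \<in> {1..n}. rtilde n v s t \<le> rtilde n w s t"
  proof (intro ballI)
    fix s t assume "s \<in> {1..n}" "t \<in> {1..n}"
    moreover from this have "s - 1 < n" "t - 1 < n" by auto
    ultimately show "rtilde n v s t \<le> rtilde n w s t"
      using le unfolding less_eq_mat_def Rtilde_def by fastforce
  qed
qed (auto simp: less_eq_mat_def Rtilde_def)

theorem theorem3p1p1:
  fixes n :: nat and v w :: "nat \<Rightarrow> nat"
  assumes "v permutes {1..n}" and "w permutes {1..n}"
  shows "KL_ideal n v w = carrier (KL_ring n v) \<longleftrightarrow> \<not> Rtilde n v \<le> Rtilde n w"
proof -
  let ?R = "KL_ring n v"
  interpret R: cring ?R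
    unfolding KL_ring_def by (rule cring_poly_ring_on)
  interpret K: ideal "KL_ideal n v w" ?R
    unfolding KL_ideal_def by (rule R.genideal_ideal[OF KL_generators_subset])
  show ?thesis
  proof (intro iffI notI)
    assume whole: "KL_ideal n v w = carrier ?R" and le: "Rtilde n v \<le> Rtilde n w"
    let ?N = "{p \<in> carrier ?R. Poly_Mapping.lookup p 0 = 0}"
    have "Poly_Mapping.lookup d 0 = 0" if d: "d \<in> KL_generators n v w" for d
    proof -
      obtain s t where st: "s \<in> {1..n}" "t \<in> {1..n}"
        and d: "d \<in> minors (rtilde n w s t + 1) (Z_southwest n v s t)"
        using d by (auto simp: KL_generators_def)
      moreover have "rtilde n v s t < rtilde n w s t + 1"
        using le st by (simp add: Rtilde_le_iff less_Suc_eq_le)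
      ultimately show ?thesis
        using lookup_minor_Z_southwest_zero_eq_0[OF assms(1)] by blast
    qed
    then have "KL_generators n v w \<subseteq> ?N"
      using KL_generators_subset by blast
    then have "KL_ideal n v w \<subseteq> ?N"
      unfolding KL_ideal_def
      by (intro R.genideal_minimal) (simp_all only: KL_ring_def ideal_zero_constant_coeff)
    then have "\<one>\<^bsub>?R\<^esub> \<in> ?N"
      using whole R.one_closed by blast
    then show False by (simp add: KL_ring_def)
  next
    assume "\<not> Rtilde n v \<le> Rtilde n w"
    then obtain s t where st: "s \<in> {1..n}" "t \<in> {1..n}" and "rtilde n w s t < rtilde n v s t"
      by (auto simp: Rtilde_le_iff not_le)
    then obtain d where d: "d \<in> minors (rtilde n w s t + 1) (Z_southwest n v s t)" "d \<in> {1, - 1}"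
      using unit_minor_Z_southwest[OF assms(1) st, of "rtilde n w s t + 1"] by auto
    have "d \<in> KL_generators n v w"
      unfolding KL_generators_def using d(1) st by blast
    then have dK: "d \<in> KL_ideal n v w"
      unfolding KL_ideal_def by (rule subsetD[OF R.genideal_self[OF KL_generators_subset]])
    have "d * d = 1" using d(2) by auto
    then have "d \<otimes>\<^bsub>?R\<^esub> d = \<one>\<^bsub>?R\<^esub>"
      by (simp add: KL_ring_def)
    then have "\<one>\<^bsub>?R\<^esub> \<in> KL_ideal n v w"
      using K.I_l_closed[OF dK K.Icarr[OF dK]] by simp
    then show "KL_ideal n v w = carrier ?R"
      by (rule K.one_imp_carrier)
  qed
qed

end
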